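(* Let $C\subseteq\mathbb{R}^d$ be a closed convex set and let $F\colon C\to\mathbb{R}^d$ be monotone and $L$-Lipschitz with $L>0$. Assume that the variational inequality "find $z^*\in C$ such that $\langle F(z^* ), z-z^*\rangle\ge 0$ for all $z\in C$" has at least one solution. Let $\varepsilon\in(0,1)$, $\alpha=\frac{1-\varepsilon}{L}$, let $(z^k)_{k\ge 0}$ be generated by GRAAL with $\phi=2$ and step size $\alpha$, and let $Z^k=\frac1k\sum_{i=1}^k z^i$ for $k\ge1$. Then $(z^k)$ converges to a solution of the variational inequality and, for every solution $z^*$ and every $k\ge 1$, $$\operatorname{Gap}(Z^k)\le \frac{32L}{(1-\varepsilon)k}\|z^0-z^*\|^2,$$ where $\operatorname{Gap}(u)=\max_{z\in S}\langle F(z),u-z\rangle$ and $S=\{z\in C:\ \|z-z^*\|^2\le 18\|z^0-z^*\|^2\}$.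
   Context: $F$ is monotone if $\langle F(x)-F(y),x-y\rangle\ge0$ for all $x,y\in C$, and $L$-Lipschitz if $\|F(x)-F(y)\|\le L\|x-y\|$ for all $x,y\in C$. $\|\cdot\|$ is the Euclidean norm and $P_C$ is the Euclidean projection onto $C$. GRAAL with parameter $\phi$ and constant step size $\alpha$ starts from $\bar z^{-1}=z^0\in C$ and iterates, for $k\ge0$, $$\bar z^k=\frac{\phi-1}{\phi}z^k+\frac1\phi\bar z^{k-1},\qquad z^{k+1}=P_C(\bar z^k-\alpha F(z^k)).$$ In particular $\bar z^0=z^0$. The function $\operatorname{Gap}$ is the restricted dual gap function over the compact set $S$. *)

theory Defs
  imports "HOL-Analysis.Analysis"
begin

definition monotone_op :: "'a::real_inner set \<Rightarrow> ('a \<Rightarrow> 'a) \<Rightarrow> bool" where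
  "monotone_op C F \<longleftrightarrow> (\<forall>x\<in>C. \<forall>y\<in>C. (F x - F y) \<bullet> (x - y) \<ge> 0)"

definition vi_solution :: "'a::real_inner set \<Rightarrow> ('a \<Rightarrow> 'a) \<Rightarrow> 'a \<Rightarrow> bool" where
  "vi_solution C F zs \<longleftrightarrow> zs \<in> C \<and> (\<forall>z\<in>C. F zs \<bullet> (z - zs) \<ge> 0)"

text \<open>
  The averaged sequence starts at index \<open>-1\<close>, so it is shifted by one:
  \<open>zb k\<close> is the averaged point with index \<open>k - 1\<close>.  Thus \<open>zb 0 = z 0\<close> is the
  initialisation, and the step from \<open>z k\<close> to \<open>z (Suc k)\<close> uses \<open>zb (Suc k)\<close>.
\<close>

definition graal ::
  "'a::euclidean_space set \<Rightarrow> ('a \<Rightarrow> 'a) \<Rightarrow> real \<Rightarrow> real \<Rightarrow> (nat \<Rightarrow> 'a) \<Rightarrow> (nat \<Rightarrow> 'a) \<Rightarrow> bool" where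
  "graal C F \<phi> \<alpha> z zb \<longleftrightarrow>
     z 0 \<in> C \<and> zb 0 = z 0 \<and>
     (\<forall>k. zb (Suc k) = ((\<phi> - 1) / \<phi>) *\<^sub>R z k + (1 / \<phi>) *\<^sub>R zb k \<and>
          z (Suc k) = closest_point C (zb (Suc k) - \<alpha> *\<^sub>R F (z k)))"

definition dual_gap :: "('a::real_inner \<Rightarrow> 'a) \<Rightarrow> 'a set \<Rightarrow> 'a \<Rightarrow> real" where
  "dual_gap F S u = (SUP z\<in>S. F z \<bullet> (u - z))"

text \<open>
  For nonempty compact \<open>S\<close> and continuous \<open>F\<close> the supremum in \<open>dual_gap\<close> is a maximum.
\<close>

lemma dual_gap_is_max:
  fixes F :: "'a::real_inner \<Rightarrow> 'a"
  assumes "compact S" "S \<noteq> {}" "continuous_on S F"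
  shows "\<exists>z\<in>S. dual_gap F S u = F z \<bullet> (u - z) \<and> (\<forall>y\<in>S. F y \<bullet> (u - y) \<le> F z \<bullet> (u - z))"
proof -
  have "continuous_on S (\<lambda>z. F z \<bullet> (u - z))"
    by (intro continuous_intros assms)
  then obtain z where z: "z \<in> S" "\<forall>y\<in>S. F y \<bullet> (u - y) \<le> F z \<bullet> (u - z)"
    using continuous_attains_sup[OF assms(1,2)] by blast
  have "dual_gap F S u = F z \<bullet> (u - z)"
    unfolding dual_gap_def using z by (intro cSup_eq_maximum) auto
  with z show ?thesis by blast
qed

end

theory Submission
  imports Defs
begin

text \<open>
  Write \<open>x k = zb (Suc k)\<close> for the averaged point of index \<open>k\<close>.  Adding the projection
  inequalities of two consecutive steps gives the usual GRAAL estimate, and for \<open>\<phi> = 2\<close> its terms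
  in \<open>\<parallel>z k - x k\<parallel>\<^sup>2\<close> telescope exactly, because \<open>z (k + 1) - x k = 2 (z (k + 1) - x (k + 1))\<close>.
  Hence
  \<open>2 \<parallel>x k - w\<parallel>\<^sup>2 - 2 \<parallel>z k - x k\<parallel>\<^sup>2 + \<alpha> L \<parallel>z k - z (k - 1)\<parallel>\<^sup>2\<close>
  decreases along the iteration for every solution \<open>w\<close>.  Despite its negative term it dominates
  \<open>\<parallel>z k - w\<parallel>\<^sup>2\<close>, so the iterates are bounded, and by \<open>\<alpha> L < 1\<close> the steps are square summable;
  hence cluster points are solutions, and the energy at a cluster point tends to \<open>0\<close>.
  For the gap, the energies at \<open>w\<close> and at another point of \<open>C\<close> differ by
  a term affine in \<open>x k\<close>, which the bound on the iterates controls.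
\<close>

locale graal_two =
  fixes C :: "'a::euclidean_space set" and F :: "'a \<Rightarrow> 'a"
    and L \<alpha> :: real and z zb :: "nat \<Rightarrow> 'a"
  assumes closed: "closed C" and convex: "convex C"
    and monotone: "monotone_op C F"
    and lipschitz: "L-lipschitz_on C F"
    and step_pos: "0 < \<alpha>" and step_le: "\<alpha> * L \<le> 1"
    and graal: "graal C F 2 \<alpha> z zb"
begin

section \<open>The iteration for \<open>\<phi> = 2\<close> and its projection inequality\<close>

lemma zb_Suc: "zb (Suc k) = (1/2) *\<^sub>R (z k + zb k)"
  using graal by (simp add: graal_def algebra_simps)

text \<open>The averaging starts at rest: \<open>x 0 = z 0\<close>, so the first step is an ordinary
  projected step from \<open>z 0\<close>.\<close>

lemma zb_0: "zb 0 = z 0" and zb_1: "zb (Suc 0) = z 0"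
  using graal by (simp_all add: graal_def algebra_simps flip: scaleR_add_left)

lemma z_Suc: "z (Suc k) = closest_point C (zb (Suc k) - \<alpha> *\<^sub>R F (z k))"
  using graal by (simp add: graal_def)

lemma z_in: "z k \<in> C"
proof (cases k)
  case 0
  then show ?thesis using graal by (simp add: graal_def)
next
  case (Suc j)
  have "C \<noteq> {}" using graal by (auto simp: graal_def)
  then show ?thesis using Suc z_Suc closest_point_in_set[OF closed] by simp
qed

lemma L_nonneg: "0 \<le> L"
  using lipschitz by (rule lipschitz_on_nonneg)

text \<open>Obtuse-angle characterisation of the projection that defines
  \<open>z (Suc k)\<close>.\<close>

lemma projection_ineq:
  assumes "w \<in> C"
  shows "0 \<le> (z (Suc k) - zb (Suc k) + \<alpha> *\<^sub>R F (z k)) \<bullet> (w - z (Suc k))"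
  using closest_point_dot[OF convex closed assms, of "zb (Suc k) - \<alpha> *\<^sub>R F (z k)"]
  unfolding z_Suc[symmetric] by (simp add: inner_diff_left inner_add_left)

section \<open>The energy and its one-step estimates\<close>

lemma lipschitz_inner:
  assumes "x \<in> C" "y \<in> C"
  shows "\<alpha> * ((F x - F y) \<bullet> v) \<le> \<alpha> * L * (norm (x - y) * norm v)"
proof -
  have "(F x - F y) \<bullet> v \<le> norm (F x - F y) * norm v"
    by (rule norm_cauchy_schwarz)
  also have "\<dots> \<le> (L * norm (x - y)) * norm v"
    using lipschitz_on_normD[OF lipschitz assms] by (intro mult_right_mono) auto
  finally show ?thesis
    using step_pos by (simp add: mult.assoc)
qed

text \<open>Index \<open>k\<close> holds the overview's energy at \<open>k + 1\<close>, so that the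
  difference to the preceding iterate starts with \<open>z 1 - z 0\<close>.\<close>

definition energy :: "'a \<Rightarrow> nat \<Rightarrow> real" where
  "energy w k = 2 * (norm (zb (Suc (Suc k)) - w))\<^sup>2 - 2 * (norm (z (Suc k) - zb (Suc (Suc k))))\<^sup>2
     + \<alpha> * L * (norm (z (Suc k) - z k))\<^sup>2"

text \<open>Here \<open>w\<close> ranges over all of \<open>C\<close>: at a solution the inner
  product is nonnegative and the energy decreases; at other points summation yields the gap
  estimate.\<close>

lemma energy_descent:
  assumes w: "w \<in> C"
  shows "energy w (Suc k) + 2 * \<alpha> * (F (z (Suc k)) \<bullet> (z (Suc k) - w))
     + 2 * (1 - \<alpha> * L) * (norm (z (Suc (Suc k)) - z (Suc k)))\<^sup>2 \<le> energy w k"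
proof -
  define a b c p q r where "a = z (Suc k)" "b = z (Suc (Suc k))" "c = z k"
    "p = zb (Suc k)" "q = zb (Suc (Suc k))" "r = zb (Suc (Suc (Suc k)))"
  note d = this
  have q: "p = 2 *\<^sub>R q - a" and r: "r = (1/2) *\<^sub>R (b + q)"
    unfolding d by (subst zb_Suc, simp)+
  \<comment> \<open>The condition for the new iterate \<open>b\<close> is tested at
    \<open>w\<close>, the one for the previous iterate \<open>a\<close> at \<open>b\<close>.\<close>
  have 1: "0 \<le> (b - q + \<alpha> *\<^sub>R F a) \<bullet> (w - b)"
    using projection_ineq[OF w] unfolding d by blast
  have 2: "0 \<le> (a - p + \<alpha> *\<^sub>R F c) \<bullet> (b - a)"
    using projection_ineq[OF z_in] unfolding d by blast
  have "\<alpha> * ((F a - F c) \<bullet> (a - b)) \<le> \<alpha> * L * (norm (a - c) * norm (a - b))"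
    unfolding d by (rule lipschitz_inner) (rule z_in)+
  also have "\<dots> \<le> \<alpha> * L * (((norm (a - c))\<^sup>2 + (norm (b - a))\<^sup>2) / 2)"
    using step_pos L_nonneg sum_squares_bound[of "norm (a - c)" "norm (a - b)"]
    by (intro mult_left_mono) (auto simp: norm_minus_commute)
  finally have 3: "2 * (\<alpha> * ((F a - F c) \<bullet> (a - b)))
      \<le> \<alpha> * L * (norm (a - c))\<^sup>2 + \<alpha> * L * (norm (b - a))\<^sup>2"
    by (simp add: algebra_simps)
  \<comment> \<open>Since \<open>a - p = 2 (a - q)\<close> and \<open>b - q = 2 (b - r)\<close>,
    only terms of two consecutive energies remain. The Lipschitz error and the last term of the next
    energy each take \<open>\<alpha> * L\<close> from the weight 2 of the squared step, leaving
    \<open>2 * (1 - \<alpha> * L)\<close>.\<close>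
  have 4: "2 * (norm (q - w))\<^sup>2 - 2 * (norm (a - q))\<^sup>2 - 2 * (norm (r - w))\<^sup>2 + 2 * (norm (b - r))\<^sup>2
      - 2 * \<alpha> * (F a \<bullet> (a - w)) - 2 * (norm (b - a))\<^sup>2
    = 2 * ((b - q + \<alpha> *\<^sub>R F a) \<bullet> (w - b)) + 2 * ((a - p + \<alpha> *\<^sub>R F c) \<bullet> (b - a))
      - 2 * (\<alpha> * ((F a - F c) \<bullet> (a - b)))"
    unfolding q r power2_norm_eq_inner
    by (simp add: inner_simps inner_commute algebra_simps)
  show ?thesis
    using 1 2 3 4 unfolding energy_def d[symmetric] by (simp add: algebra_simps)
qed

text \<open>Minty form of the variational inequality; it gives the sign of the inner product in
  \<open>energy_descent\<close>.\<close>

lemma solution_ineq: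
  assumes "vi_solution C F w" "x \<in> C"
  shows "0 \<le> F x \<bullet> (x - w)"
proof -
  have "0 \<le> (F x - F w) \<bullet> (x - w)" "0 \<le> F w \<bullet> (x - w)"
    using assms monotone by (auto simp: vi_solution_def monotone_op_def)
  then show ?thesis by (simp add: inner_diff_left)
qed

text \<open>
  The negative term of the energy is absorbed by testing a single projection inequality
  at the solution and using monotonicity.
\<close>

lemma energy_lower:
  assumes w: "vi_solution C F w"
  shows "(norm (z (Suc k) - w))\<^sup>2 \<le> energy w k"
proof -
  define a c p q where "a = z (Suc k)" "c = z k" "p = zb (Suc k)" "q = zb (Suc (Suc k))"
  note d = this
  have q: "p = 2 *\<^sub>R q - a" unfolding d by (subst zb_Suc, simp)
  have 1: "0 \<le> (a - p + \<alpha> *\<^sub>R F c) \<bullet> (w - a)"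
    using projection_ineq w unfolding d vi_solution_def by blast
  have 2: "0 \<le> \<alpha> * (F a \<bullet> (a - w))"
    using solution_ineq[OF w z_in] step_pos unfolding d by simp
  have "\<alpha> * ((F c - F a) \<bullet> (w - a)) \<le> \<alpha> * L * (norm (c - a) * norm (w - a))"
    unfolding d by (rule lipschitz_inner) (rule z_in)+
  also have "\<dots> \<le> \<alpha> * L * (((norm (a - c))\<^sup>2 + (norm (a - w))\<^sup>2) / 2)"
    using step_pos L_nonneg sum_squares_bound[of "norm (a - c)" "norm (a - w)"]
    by (intro mult_left_mono) (auto simp: norm_minus_commute)
  finally have 3: "2 * (\<alpha> * ((F c - F a) \<bullet> (w - a)))
      \<le> \<alpha> * L * (norm (a - c))\<^sup>2 + \<alpha> * L * (norm (a - w))\<^sup>2"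
    by (simp add: algebra_simps)
  have 4: "2 * (norm (q - w))\<^sup>2 - 2 * (norm (a - q))\<^sup>2 = 2 * (norm (a - w))\<^sup>2
      + 2 * ((a - p + \<alpha> *\<^sub>R F c) \<bullet> (w - a)) - 2 * (\<alpha> * ((F c - F a) \<bullet> (w - a)))
      + 2 * (\<alpha> * (F a \<bullet> (a - w)))"
    unfolding q power2_norm_eq_inner
    by (simp add: inner_simps inner_commute algebra_simps)
  \<comment> \<open>Of the two copies of the squared distance of \<open>a\<close> to
    \<open>w\<close> in 4, the Lipschitz error uses at most one; its other part is paid by the last
    term of the energy.\<close>
  have 5: "\<alpha> * L * (norm (a - w))\<^sup>2 \<le> (norm (a - w))\<^sup>2"
    using step_le by (simp add: mult_left_le_one_le step_pos L_nonneg less_imp_le)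
  show ?thesis
    using 1 2 3 4 5 unfolding energy_def d[symmetric] by simp
qed

section \<open>Bounds in terms of the initial distance to a solution\<close>

lemma first_step:
  assumes w: "vi_solution C F w"
  shows "(norm (z (Suc 0) - w))\<^sup>2 \<le> 2 * (norm (z 0 - w))\<^sup>2"
proof -
  let ?b = "z (Suc 0)"
  have wC: "w \<in> C" using w by (simp add: vi_solution_def)
  \<comment> \<open>\<open>v\<close> is the difference of the forward steps from \<open>z 0\<close>
    and from \<open>w\<close>. As \<open>w\<close> is the projection of its own forward step,
    nonexpansiveness bounds the new distance by \<open>norm v\<close>; monotonicity signs the cross
    term of its square.\<close>
  define v where "v = z 0 - w - \<alpha> *\<^sub>R (F (z 0) - F w)"
  have 1: "0 \<le> (?b - z 0 + \<alpha> *\<^sub>R F (z 0)) \<bullet> (w - ?b)"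
    using projection_ineq[OF wC, of 0] by (simp add: zb_1)
  have 2: "0 \<le> \<alpha> * (F w \<bullet> (?b - w))"
    using w z_in[of "Suc 0"] step_pos by (simp add: vi_solution_def)
  have "(norm (?b - w))\<^sup>2 \<le> v \<bullet> (?b - w)"
    using 1 2 unfolding v_def power2_norm_eq_inner
    by (simp add: inner_simps inner_commute algebra_simps)
  also have "\<dots> \<le> norm v * norm (?b - w)"
    by (rule norm_cauchy_schwarz)
  also have "\<dots> \<le> ((norm v)\<^sup>2 + (norm (?b - w))\<^sup>2) / 2"
    using sum_squares_bound[of "norm v" "norm (?b - w)"] by simp
  finally have 3: "(norm (?b - w))\<^sup>2 \<le> (norm v)\<^sup>2" by simp
  have 4: "0 \<le> \<alpha> * ((F (z 0) - F w) \<bullet> (z 0 - w))"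
    using monotone wC z_in step_pos by (simp add: monotone_op_def)
  have "norm (\<alpha> *\<^sub>R (F (z 0) - F w)) \<le> \<alpha> * (L * norm (z 0 - w))"
    using lipschitz_on_normD[OF lipschitz z_in wC] step_pos by simp
  also have "\<dots> \<le> norm (z 0 - w)"
    using step_le mult_right_mono[OF step_le, of "norm (z 0 - w)"] by (simp add: mult.assoc)
  finally have 5: "(norm (\<alpha> *\<^sub>R (F (z 0) - F w)))\<^sup>2 \<le> (norm (z 0 - w))\<^sup>2"
    by (rule power_mono) simp
  have "(norm v)\<^sup>2 = (norm (z 0 - w))\<^sup>2 - 2 * (\<alpha> * ((F (z 0) - F w) \<bullet> (z 0 - w)))
      + (norm (\<alpha> *\<^sub>R (F (z 0) - F w)))\<^sup>2"
    unfolding v_def power2_norm_eq_inner by (simp add: inner_simps inner_commute algebra_simps)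
  with 3 4 5 show ?thesis by linarith
qed

text \<open>The constant 3 is 2 from \<open>first_step\<close> plus 1 from \<open>z 0\<close>. The
  negative term of the parallelogram law absorbs the Lipschitz term.\<close>

lemma energy_first:
  assumes w: "vi_solution C F w"
  shows "energy w 0 \<le> 3 * (norm (z 0 - w))\<^sup>2"
proof -
  let ?b = "z (Suc 0)"
  have q: "zb (Suc (Suc 0)) = (1/2) *\<^sub>R (?b + z 0)"
    by (simp add: zb_Suc[of "Suc 0"] zb_1)
  have "2 * (norm (zb (Suc (Suc 0)) - w))\<^sup>2 - 2 * (norm (?b - zb (Suc (Suc 0))))\<^sup>2
      = (norm (?b - w))\<^sup>2 + (norm (z 0 - w))\<^sup>2 - (norm (?b - z 0))\<^sup>2"
    unfolding q power2_norm_eq_inner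
    by (simp add: inner_simps inner_commute algebra_simps)
  moreover have "\<alpha> * L * (norm (?b - z 0))\<^sup>2 \<le> (norm (?b - z 0))\<^sup>2"
    using step_le by (simp add: mult_left_le_one_le step_pos L_nonneg less_imp_le)
  ultimately show ?thesis
    using first_step[OF w] unfolding energy_def by linarith
qed

lemma energy_decseq:
  assumes w: "vi_solution C F w"
  shows "decseq (energy w)"
proof (rule decseq_SucI)
  fix k
  have "0 \<le> 2 * \<alpha> * (F (z (Suc k)) \<bullet> (z (Suc k) - w))"
    "0 \<le> 2 * (1 - \<alpha> * L) * (norm (z (Suc (Suc k)) - z (Suc k)))\<^sup>2"
    using solution_ineq[OF w z_in] step_pos step_le by auto
  then show "energy w (Suc k) \<le> energy w k"
    using energy_descent[of w k] w by (simp add: vi_solution_def)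
qed

lemma z_bound:
  assumes w: "vi_solution C F w"
  shows "(norm (z k - w))\<^sup>2 \<le> 3 * (norm (z 0 - w))\<^sup>2"
proof (cases k)
  case (Suc j)
  have "energy w j \<le> energy w 0"
    using energy_decseq[OF w] by (simp add: decseq_def)
  then show ?thesis
    using energy_lower[OF w, of j] energy_first[OF w] Suc by simp
qed simp

text \<open>Each average is a midpoint, so convexity of the squared distance carries over the bound
  on \<open>z\<close> with the same constant.\<close>

lemma zb_bound:
  assumes w: "vi_solution C F w"
  shows "(norm (zb k - w))\<^sup>2 \<le> 3 * (norm (z 0 - w))\<^sup>2"
proof (induction k)
  case (Suc k)
  have "4 * (norm (zb (Suc k) - w))\<^sup>2 = 2 * (norm (z k - w))\<^sup>2 + 2 * (norm (zb k - w))\<^sup>2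
      - (norm (z k - zb k))\<^sup>2"
    unfolding zb_Suc power2_norm_eq_inner
    by (simp add: inner_simps inner_commute algebra_simps)
  then show ?case
    using Suc z_bound[OF w, of k] zero_le_power2[of "norm (z k - zb k)"] by linarith
qed (simp add: zb_0)

section \<open>Gap estimate for the averages\<close>

lemma sum_descent:
  assumes w: "w \<in> C"
  shows "energy w n + (\<Sum>i=1..n. 2 * \<alpha> * (F (z i) \<bullet> (z i - w)))
    + (\<Sum>i=1..n. 2 * (1 - \<alpha> * L) * (norm (z (Suc i) - z i))\<^sup>2) \<le> energy w 0"
proof (induction n)
  case (Suc n)
  then show ?case using energy_descent[OF w, of n] by simp
qed simp

lemma averaged_gap:
  assumes w: "vi_solution C F w" and x: "x \<in> C" "(norm (x - w))\<^sup>2 \<le> 18 * (norm (z 0 - w))\<^sup>2"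
  shows "\<alpha> * (F x \<bullet> (\<Sum>i=1..n. z i - x)) \<le> 32 * (norm (z 0 - w))\<^sup>2"
proof -
  let ?N = "(norm (z 0 - w))\<^sup>2"
  let ?p = "zb (Suc (Suc 0))" and ?q = "zb (Suc (Suc n))"
  \<comment> \<open>Monotonicity replaces \<open>F (z i)\<close> by the fixed vector
    \<open>F x\<close>, which can be pulled out of the sum.\<close>
  have "(\<Sum>i=1..n. 2 * \<alpha> * (F x \<bullet> (z i - x))) \<le> (\<Sum>i=1..n. 2 * \<alpha> * (F (z i) \<bullet> (z i - x)))"
  proof (rule sum_mono)
    fix i
    have "0 \<le> (F (z i) - F x) \<bullet> (z i - x)"
      using monotone x z_in by (simp add: monotone_op_def)
    then show "2 * \<alpha> * (F x \<bullet> (z i - x)) \<le> 2 * \<alpha> * (F (z i) \<bullet> (z i - x))"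
      using step_pos by (simp add: inner_diff_left)
  qed
  moreover have "(\<Sum>i=1..n. 2 * \<alpha> * (F x \<bullet> (z i - x))) = 2 * \<alpha> * (F x \<bullet> (\<Sum>i=1..n. z i - x))"
    by (simp only: inner_sum_right sum_distrib_left)
  moreover have "0 \<le> (\<Sum>i=1..n. 2 * (1 - \<alpha> * L) * (norm (z (Suc i) - z i))\<^sup>2)"
    using step_le by (intro sum_nonneg) auto
  ultimately have 1: "2 * (\<alpha> * (F x \<bullet> (\<Sum>i=1..n. z i - x))) \<le> energy x 0 - energy x n"
    using sum_descent[OF x(1), of n] by simp
  \<comment> \<open>The terms quadratic in \<open>x\<close> cancel between the indices 0 and
    \<open>n\<close>; only a linear one survives.\<close>
  have 2: "energy x 0 - energy x n = energy w 0 - energy w n + 4 * ((?q - ?p) \<bullet> (x - w))"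
    unfolding energy_def power2_norm_eq_inner by (simp add: inner_simps inner_commute algebra_simps)
  have "energy w 0 - energy w n \<le> 3 * ?N"
    using energy_first[OF w] energy_lower[OF w, of n] zero_le_power2[of "norm (z (Suc n) - w)"]
    by linarith
  moreover have "(?q - ?p) \<bullet> (x - w) \<le> 15 * ?N"
  proof -
    have "(norm (?q - ?p))\<^sup>2 = 2 * (norm (?q - w))\<^sup>2 + 2 * (norm (?p - w))\<^sup>2 - (norm (?q + ?p - 2 *\<^sub>R w))\<^sup>2"
      unfolding power2_norm_eq_inner by (simp add: inner_simps inner_commute algebra_simps)
    \<comment> \<open>Two bounds from \<open>zb_bound\<close> give 12 = 2 * 3 + 2 * 3. With the
      radius constant 18 the product 216 stays below 225, the square of 15.\<close>
    then have "(norm (?q - ?p))\<^sup>2 \<le> 12 * ?N"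
      using zb_bound[OF w] zero_le_power2[of "norm (?q + ?p - 2 *\<^sub>R w)"]
      by (smt (verit))
    then have "(norm (?q - ?p))\<^sup>2 * (norm (x - w))\<^sup>2 \<le> (12 * ?N) * (18 * ?N)"
      using x(2) by (intro mult_mono) auto
    also have "\<dots> \<le> (15 * ?N)\<^sup>2"
      by (simp add: power2_eq_square)
    finally have "(norm (?q - ?p) * norm (x - w))\<^sup>2 \<le> (15 * ?N)\<^sup>2"
      by (simp add: power_mult_distrib)
    then have "norm (?q - ?p) * norm (x - w) \<le> 15 * ?N"
      by (rule power2_le_imp_le) simp
    then show ?thesis using norm_cauchy_schwarz[of "?q - ?p" "x - w"] by linarith
  qed
  \<comment> \<open>63 = 3 + 4 * 15, and half of it is below 32.\<close>
  ultimately have "2 * (\<alpha> * (F x \<bullet> (\<Sum>i=1..n. z i - x))) \<le> 63 * ?N"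
    using 1 2 by linarith
  then show ?thesis using zero_le_power2[of "norm (z 0 - w)"] by linarith
qed

section \<open>Square-summable steps and convergence of the iterates\<close>

lemma summable_steps:
  assumes w: "vi_solution C F w" and strict: "\<alpha> * L < 1"
  shows "summable (\<lambda>k. (norm (z (Suc k) - z k))\<^sup>2)"
proof -
  have "summable (\<lambda>k. (norm (z (Suc (Suc k)) - z (Suc k)))\<^sup>2)"
  proof (rule summableI_nonneg_bounded)
    fix n
    have "(\<Sum>k<n. 2 * (1 - \<alpha> * L) * (norm (z (Suc (Suc k)) - z (Suc k)))\<^sup>2) + energy w n \<le> energy w 0"
    proof (induction n)
      case (Suc n)
      have "0 \<le> 2 * \<alpha> * (F (z (Suc n)) \<bullet> (z (Suc n) - w))"
        using solution_ineq[OF w z_in] step_pos by simp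
      then show ?case using Suc energy_descent[of w n] w by (simp add: vi_solution_def)
    qed simp
    moreover have "0 \<le> energy w n"
      using energy_lower[OF w, of n] zero_le_power2 order_trans by blast
    ultimately have "2 * (1 - \<alpha> * L) * (\<Sum>k<n. (norm (z (Suc (Suc k)) - z (Suc k)))\<^sup>2) \<le> energy w 0"
      by (simp flip: sum_distrib_left)
    \<comment> \<open>Strictness of \<open>\<alpha> * L < 1\<close> makes the weight positive, so it
      can be divided out.\<close>
    then show "(\<Sum>k<n. (norm (z (Suc (Suc k)) - z (Suc k)))\<^sup>2) \<le> energy w 0 / (2 * (1 - \<alpha> * L))"
      using strict by (simp add: field_simps)
  qed simp
  \<comment> \<open>The descent starts with the step \<open>z 2 - z 1\<close>; adding the single
    term for \<open>z 1 - z 0\<close> preserves summability.\<close>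
  then show ?thesis by (subst (asm) summable_Suc_iff)
qed

lemma z_diff_tendsto:
  assumes "vi_solution C F w" "\<alpha> * L < 1"
  shows "(\<lambda>k. z (Suc k) - z k) \<longlonglongrightarrow> 0"
proof -
  have "(\<lambda>k. sqrt ((norm (z (Suc k) - z k))\<^sup>2)) \<longlonglongrightarrow> sqrt 0"
    by (intro tendsto_real_sqrt summable_LIMSEQ_zero summable_steps[OF assms])
  then show ?thesis by (simp add: tendsto_norm_zero_iff)
qed

text \<open>The lag \<open>u\<close> of the average behind the iterate is halved in each round and
  driven by the steps, so it inherits square summability.\<close>

lemma z_zb_tendsto:
  assumes "vi_solution C F w" "\<alpha> * L < 1"
  shows "(\<lambda>k. z k - zb (Suc k)) \<longlonglongrightarrow> 0"
proof -
  define u where "u k = z k - zb (Suc k)" for k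
  have u_Suc: "2 * (norm (u (Suc k)))\<^sup>2 \<le> (norm (z (Suc k) - z k))\<^sup>2 + (norm (u k))\<^sup>2" for k
  proof -
    have u': "u (Suc k) = (1/2) *\<^sub>R ((z (Suc k) - z k) + u k)"
      unfolding u_def zb_Suc[of "Suc k"] by (simp add: algebra_simps flip: scaleR_add_left)
    have "2 * (norm (u (Suc k)))\<^sup>2 = (norm (z (Suc k) - z k))\<^sup>2 + (norm (u k))\<^sup>2
        - (norm (z (Suc k) - z k - u k))\<^sup>2 / 2"
      unfolding u' power2_norm_eq_inner
      by (simp add: inner_simps inner_commute algebra_simps) (simp add: field_simps)
    then show ?thesis using zero_le_power2[of "norm (z (Suc k) - z k - u k)"] by linarith
  qed
  have "summable (\<lambda>k. (norm (u (Suc k)))\<^sup>2)"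
  proof (rule summableI_nonneg_bounded)
    fix n
    \<comment> \<open>The extra term for \<open>u n\<close> makes the induction close:
      \<open>u_Suc\<close> pays for two copies of the next square. It starts at
      \<open>u 0 = 0\<close>.\<close>
    have "(\<Sum>k<n. (norm (u (Suc k)))\<^sup>2) + (norm (u n))\<^sup>2 \<le> (\<Sum>k<n. (norm (z (Suc k) - z k))\<^sup>2)"
    proof (induction n)
      case 0
      then show ?case by (simp add: u_def zb_1)
    next
      case (Suc n)
      then show ?case using u_Suc[of n] by simp
    qed
    also have "\<dots> \<le> (\<Sum>k. (norm (z (Suc k) - z k))\<^sup>2)"
      by (intro sum_le_suminf summable_steps[OF assms]) auto
    finally show "(\<Sum>k<n. (norm (u (Suc k)))\<^sup>2) \<le> (\<Sum>k. (norm (z (Suc k) - z k))\<^sup>2)"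
      using zero_le_power2[of "norm (u n)"] by linarith
  qed simp
  then have "summable (\<lambda>k. (norm (u k))\<^sup>2)" by (subst (asm) summable_Suc_iff)
  then have "(\<lambda>k. sqrt ((norm (u k))\<^sup>2)) \<longlonglongrightarrow> sqrt 0"
    by (intro tendsto_real_sqrt summable_LIMSEQ_zero)
  then show ?thesis by (simp add: tendsto_norm_zero_iff u_def)
qed

lemma z_tendsto_solution:
  assumes w: "vi_solution C F w" and strict: "\<alpha> * L < 1"
  shows "\<exists>y. vi_solution C F y \<and> z \<longlonglongrightarrow> y"
proof -
  have "bounded (range z)"
  proof (rule boundedI)
    fix x assume "x \<in> range z"
    then obtain k where k: "x = z k" by blast
    \<comment> \<open>Relaxing 3 to 4 makes the bound a perfect square.\<close>
    have "(norm (z k - w))\<^sup>2 \<le> (2 * norm (z 0 - w))\<^sup>2"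
      using z_bound[OF w, of k] zero_le_power2[of "norm (z 0 - w)"]
        four_x_squared[of "norm (z 0 - w)"] by linarith
    then have "norm (z k - w) \<le> 2 * norm (z 0 - w)"
      by (rule power2_le_imp_le) simp
    then show "norm x \<le> norm w + 2 * norm (z 0 - w)"
      unfolding k using norm_triangle_sub[of "z k" w] by linarith
  qed
  then obtain y r where r: "strict_mono r" and lim: "(z \<circ> r) \<longlonglongrightarrow> y"
    using bounded_imp_convergent_subsequence by blast
  have zr: "(\<lambda>k. z (r k)) \<longlonglongrightarrow> y" using lim by (simp add: o_def)
  have yC: "y \<in> C" using closed_sequentially[OF closed _ zr] z_in by blast
  have d: "(\<lambda>k. z (Suc (r k)) - z (r k)) \<longlonglongrightarrow> 0"
    using LIMSEQ_subseq_LIMSEQ[OF z_diff_tendsto[OF w strict] r] by (simp add: o_def)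
  have u: "(\<lambda>k. z (r k) - zb (Suc (r k))) \<longlonglongrightarrow> 0"
    using LIMSEQ_subseq_LIMSEQ[OF z_zb_tendsto[OF w strict] r] by (simp add: o_def)
  have zSr: "(\<lambda>k. z (Suc (r k))) \<longlonglongrightarrow> y"
    using tendsto_add[OF d zr] by simp
  have zbr: "(\<lambda>k. zb (Suc (r k))) \<longlonglongrightarrow> y"
    using tendsto_diff[OF zr u] by simp
  have Fr: "(\<lambda>k. F (z (r k))) \<longlonglongrightarrow> F y"
    by (rule continuous_on_tendsto_compose[OF lipschitz_on_continuous_on[OF lipschitz] zr yC])
      (simp add: z_in)
  have y: "vi_solution C F y"
    unfolding vi_solution_def
  proof (intro conjI ballI yC)
    fix v assume v: "v \<in> C"
    \<comment> \<open>The projection inequality passes to the limit because iterate, successor and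
      average share the cluster point \<open>y\<close>.\<close>
    have "(\<lambda>k. (z (Suc (r k)) - zb (Suc (r k)) + \<alpha> *\<^sub>R F (z (r k))) \<bullet> (v - z (Suc (r k))))
        \<longlonglongrightarrow> (y - y + \<alpha> *\<^sub>R F y) \<bullet> (v - y)"
      by (intro tendsto_intros zSr zbr Fr)
    then have "0 \<le> (y - y + \<alpha> *\<^sub>R F y) \<bullet> (v - y)"
      by (rule LIMSEQ_le_const) (use projection_ineq[OF v] in auto)
    then show "0 \<le> F y \<bullet> (v - y)"
      using step_pos by (simp add: zero_le_mult_iff)
  qed
  \<comment> \<open>The energy is recentred at \<open>y\<close>, now known to be a solution. Being
    monotone and bounded below, it has a limit, which the subsequence identifies as 0.\<close>
  have energy_nonneg: "0 \<le> energy y k" for k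
    using energy_lower[OF y, of k] zero_le_power2 order_trans by blast
  obtain e where e: "energy y \<longlonglongrightarrow> e"
    using decseq_convergent[OF energy_decseq[OF y], of 0] energy_nonneg by blast
  have zbSr: "(\<lambda>k. zb (Suc (Suc (r k)))) \<longlonglongrightarrow> (1/2) *\<^sub>R (y + y)"
    unfolding zb_Suc[of "Suc (r _)"] by (intro tendsto_intros zSr zbr)
  have "(\<lambda>k. energy y (r k)) \<longlonglongrightarrow> 2 * (norm ((1/2) *\<^sub>R (y + y) - y))\<^sup>2
      - 2 * (norm (y - (1/2) *\<^sub>R (y + y)))\<^sup>2 + \<alpha> * L * (norm (y - y))\<^sup>2"
    unfolding energy_def by (intro tendsto_intros zSr zr zbSr)
  then have "(\<lambda>k. energy y (r k)) \<longlonglongrightarrow> 0"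
    by (simp flip: scaleR_2)
  moreover have "(\<lambda>k. energy y (r k)) \<longlonglongrightarrow> e"
    using LIMSEQ_subseq_LIMSEQ[OF e r] by (simp add: o_def)
  ultimately have "e = 0" using LIMSEQ_unique by blast
  have "(\<lambda>k. (norm (z (Suc k) - y))\<^sup>2) \<longlonglongrightarrow> 0"
    by (rule tendsto_sandwich[OF _ _ tendsto_const e[unfolded \<open>e = 0\<close>]])
      (auto simp: energy_lower[OF y])
  then have "(\<lambda>k. sqrt ((norm (z (Suc k) - y))\<^sup>2)) \<longlonglongrightarrow> sqrt 0"
    by (intro tendsto_real_sqrt)
  then have "(\<lambda>k. z (Suc k)) \<longlonglongrightarrow> y"
    by (simp add: tendsto_norm_zero_iff LIM_zero_iff)
  then show ?thesis using y LIMSEQ_imp_Suc by blast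
qed

end

theorem corollary2:
  fixes C :: "(real ^ 'd) set" and F :: "real ^ 'd \<Rightarrow> real ^ 'd"
    and L \<epsilon> \<alpha> :: real and z zb Z :: "nat \<Rightarrow> real ^ 'd"
  assumes "closed C" "convex C"
    and "monotone_op C F"
    and "L > 0" "L-lipschitz_on C F"
    and "\<exists>zs. vi_solution C F zs"
    and "0 < \<epsilon>" "\<epsilon> < 1"
    and "\<alpha> = (1 - \<epsilon>) / L"
    and "graal C F 2 \<alpha> z zb"
    and "\<And>k. k \<ge> 1 \<Longrightarrow> Z k = (1 / real k) *\<^sub>R (\<Sum>i=1..k. z i)"
  shows "(\<exists>zs. vi_solution C F zs \<and> z \<longlonglongrightarrow> zs) \<and>
    (\<forall>zs k. vi_solution C F zs \<and> k \<ge> 1 \<longrightarrow>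
      dual_gap F {w \<in> C. (norm (w - zs))\<^sup>2 \<le> 18 * (norm (z 0 - zs))\<^sup>2} (Z k)
        \<le> 32 * L / ((1 - \<epsilon>) * real k) * (norm (z 0 - zs))\<^sup>2)"
proof -
  have \<alpha>L: "\<alpha> * L = 1 - \<epsilon>" using assms by simp
  interpret graal_two C F L \<alpha> z zb
    using assms \<alpha>L by unfold_locales auto
  have "dual_gap F {w \<in> C. (norm (w - zs))\<^sup>2 \<le> 18 * (norm (z 0 - zs))\<^sup>2} (Z k)
        \<le> 32 * L / ((1 - \<epsilon>) * real k) * (norm (z 0 - zs))\<^sup>2"
    if zs: "vi_solution C F zs" and k: "k \<ge> 1" for zs k
    unfolding dual_gap_def
  proof (rule cSUP_least)
    show "{w \<in> C. (norm (w - zs))\<^sup>2 \<le> 18 * (norm (z 0 - zs))\<^sup>2} \<noteq> {}"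
      using zs by (auto simp: vi_solution_def intro!: exI[of _ zs])
  next
    fix x assume "x \<in> {w \<in> C. (norm (w - zs))\<^sup>2 \<le> 18 * (norm (z 0 - zs))\<^sup>2}"
    then have "\<alpha> * (F x \<bullet> (\<Sum>i=1..k. z i - x)) \<le> 32 * (norm (z 0 - zs))\<^sup>2"
      using averaged_gap[OF zs] by simp
    moreover have "(\<Sum>i=1..k. z i - x) = real k *\<^sub>R (Z k - x)"
      using k by (simp add: assms(11) sum_subtractf scaleR_diff_right sum_constant_scaleR
          del: sum_constant)
    ultimately have "\<alpha> * (real k * (F x \<bullet> (Z k - x))) \<le> 32 * (norm (z 0 - zs))\<^sup>2"
      by simp
    \<comment> \<open>Division by \<open>\<alpha> * real k\<close> with
      \<open>\<alpha> = (1 - \<epsilon>) / L\<close> produces the stated factor.\<close>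
    then show "F x \<bullet> (Z k - x) \<le> 32 * L / ((1 - \<epsilon>) * real k) * (norm (z 0 - zs))\<^sup>2"
      using k assms(4,7,8,9) by (simp add: field_simps)
  qed
  moreover have "\<alpha> * L < 1" using \<alpha>L assms(7) by simp
  ultimately show ?thesis
    using z_tendsto_solution assms(6) by blast
qed

end
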